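(* Let $\mathscr{B}\subset\mathbb{N}\setminus\{1\}$. Then $\mathcal{M}_{\mathscr{B}}$ and $\mathcal{F}_{\mathscr{B}}$ are rational if and only if $\mathscr{B}$ is Besicovitch.
   Context: $\mathbb{N}=\{1,2,3,\dots\}$. $\mathcal{M}_{\mathscr{B}}=\bigcup_{b\in\mathscr{B}}b\mathbb{N}$ is the set of multiples of $\mathscr{B}$ and $\mathcal{F}_{\mathscr{B}}=\mathbb{N}\setminus\mathcal{M}_{\mathscr{B}}$ is the set of $\mathscr{B}$-free numbers. $\mathscr{B}$ is Besicovitch if the density $d(\mathcal{M}_{\mathscr{B}})=\lim_{N\to\infty}\frac1N|\mathcal{M}_{\mathscr{B}}\cap\{1,\dots,N\}|$ exists (equivalently, $d(\mathcal{F}_{\mathscr{B}})$ exists). For $x,y\in\{0,1\}^{\mathbb{N}}$ put $d_B(x,y)=\limsup_{N\to\infty}\frac1N|\{1\le n\le N: x(n)\ne y(n)\}|$. A set $R\subset\mathbb{N}$ is rational if for every $\varepsilon>0$ there is a periodic sequence $y\in\{0,1\}^{\mathbb{N}}$ with $d_B(\mathbf{1}_R,y)<\varepsilon$. *)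

theory Defs
  imports "HOL-Analysis.Analysis"
begin

text \<open>The natural numbers of the text start at 1.\<close>

abbreviation pos_nats :: "nat set" where
  "pos_nats \<equiv> {1..}"

definition multiples :: "nat set \<Rightarrow> nat set" where
  "multiples B = (\<Union>b\<in>B. {b * k |k. k \<in> pos_nats})"

definition free_numbers :: "nat set \<Rightarrow> nat set" where
  "free_numbers B = pos_nats - multiples B"

definition has_density :: "nat set \<Rightarrow> real \<Rightarrow> bool" where
  "has_density A d \<longleftrightarrow> (\<lambda>N. real (card (A \<inter> {1..N})) / real N) \<longlonglongrightarrow> d"

definition Besicovitch :: "nat set \<Rightarrow> bool" where
  "Besicovitch B \<longleftrightarrow> (\<exists>d. has_density (multiples B) d)"

text \<open>
  Sequences over \<open>{0, 1}\<close> indexed by the positive integers are functions on \<open>nat\<close> that take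
  values in \<open>{0, 1}\<close> on \<open>pos_nats\<close>; the value at \<open>0\<close> plays no role. Limes superior is taken in
  the extended reals.
\<close>

definition binary_seqs :: "(nat \<Rightarrow> nat) set" where
  "binary_seqs = {x. \<forall>n\<in>pos_nats. x n \<in> {0, 1}}"

definition besicovitch_dist :: "(nat \<Rightarrow> nat) \<Rightarrow> (nat \<Rightarrow> nat) \<Rightarrow> ereal" where
  "besicovitch_dist x y =
     limsup (\<lambda>N. ereal (real (card {n \<in> {1..N}. x n \<noteq> y n}) / real N))"

definition periodic_seq :: "(nat \<Rightarrow> nat) \<Rightarrow> bool" where
  "periodic_seq y \<longleftrightarrow> (\<exists>p\<ge>1. \<forall>n\<in>pos_nats. y (n + p) = y n)"

definition rational_set :: "nat set \<Rightarrow> bool" where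
  "rational_set R \<longleftrightarrow> R \<subseteq> pos_nats \<and>
     (\<forall>\<epsilon>::real. \<epsilon> > 0 \<longrightarrow>
       (\<exists>y\<in>binary_seqs. periodic_seq y \<and> besicovitch_dist (indicator R) y < ereal \<epsilon>))"

end

theory Submission
  imports Defs "HOL-Computational_Algebra.Primes"
begin

text \<open>
  Rationality implies a density for any set: a periodic sequence has a mean value, and if a set is
  approximated by periodic sequences up to Besicovitch distance \<open>\<epsilon>\<close>, its counting averages
  eventually vary by no more than a multiple of \<open>\<epsilon>\<close>, so they form a Cauchy sequence
  (\<open>rational_set_imp_density\<close>).

  Conversely, the sets of multiples \<open>M\<^sub>K\<close> of the truncations \<open>B \<inter> {..K}\<close> are periodic and increase
  to the set of multiples \<open>M\<close> of \<open>B\<close>. They approximate \<open>M\<close> once the density \<open>d\<close> of \<open>M\<close>, when it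
  exists, is the supremum of the densities \<open>d\<^sub>K\<close> of the \<open>M\<^sub>K\<close>. This is a form of the theorem of
  Davenport and Erdos (\<open>Davenport_Erdos_density_le\<close>). Natural density is not countably additive, so
  the supremum cannot be taken directly; it is taken for the probability
  measures \<open>P\<^sub>s(A) = (\<Sum>n\<in>A. n\<^sup>-\<^sup>s) / \<zeta>(s)\<close> with \<open>s > 1\<close> instead, where \<open>P\<^sub>s(M)\<close> is the limit
  of \<open>P\<^sub>s(M\<^sub>K)\<close>. Two facts connect them with density.
  \<^item> If \<open>A\<close> has natural density \<open>a\<close>, then \<open>P\<^sub>s(A) \<longlongrightarrow> a\<close> as \<open>s\<close> decreases to 1
    (\<open>density_imp_zeta_density\<close>).
  \<^item> If \<open>A\<close> is closed under taking multiples, \<open>P\<^sub>s(A)\<close> increases as \<open>s\<close> decreases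
    (\<open>zeta_distribution_antimono\<close>). Indeed under \<open>P\<^sub>s\<close> the \<open>p\<close>-adic valuations are independent
    geometric variables, each of which grows stochastically when \<open>s\<close> decreases, so that a
    \<open>P\<^sub>u\<close>-random integer with \<open>u < s\<close> is distributed like a \<open>P\<^sub>s\<close>-random integer times an
    independent positive integer.

  Together they give \<open>P\<^sub>s(M\<^sub>K) \<le> d\<^sub>K \<le> \<theta>\<close> for every \<open>s > 1\<close>, where \<open>\<theta>\<close> is any upper bound of
  the \<open>d\<^sub>K\<close>. Letting \<open>K\<close> grow gives \<open>P\<^sub>s(M) \<le> \<theta>\<close>, and letting \<open>s\<close> decrease to 1 gives \<open>d \<le> \<theta>\<close>.
\<close>

section \<open>Counting functions and periodic sets\<close>

lemma card_Suc_inter: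
  "card (A \<inter> {1..Suc n}) = card (A \<inter> {1..n}) + (if Suc n \<in> A then 1 else 0)"
proof -
  have "A \<inter> {1..Suc n} = (if Suc n \<in> A then insert (Suc n) (A \<inter> {1..n}) else A \<inter> {1..n})"
    by (auto simp: le_Suc_eq)
  then show ?thesis by auto
qed

lemma card_periodic_shift:
  assumes per: "\<And>n. n \<ge> 1 \<Longrightarrow> n + p \<in> A \<longleftrightarrow> n \<in> A"
  shows "card (A \<inter> {1..r + k * p}) = card (A \<inter> {1..r}) + k * card (A \<inter> {1..p})"
proof -
  have one: "card (A \<inter> {1..m + p}) = card (A \<inter> {1..m}) + card (A \<inter> {1..p})" for m
  proof (induction m)
    case (Suc m)
    then show ?case
      using per[of "Suc m"] card_Suc_inter[of A "m + p"] card_Suc_inter[of A m] by simp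
  qed simp
  show ?thesis
  proof (induction k)
    case (Suc k)
    have "r + Suc k * p = (r + k * p) + p" by simp
    then show ?case using one[of "r + k * p"] Suc by (simp only: mult_Suc)
  qed simp
qed

text \<open>
  With \<open>c\<close> elements in one period, the count up to \<open>N\<close> differs from \<open>N c / p\<close> only through the last,
  incomplete period, hence by at most \<open>p\<close>.
\<close>

lemma periodic_has_density:
  assumes p: "p \<ge> 1" and per: "\<And>n. n \<ge> 1 \<Longrightarrow> n + p \<in> A \<longleftrightarrow> n \<in> A"
  shows "\<exists>d. has_density A d"
proof -
  define c where "c = card (A \<inter> {1..p})"
  have cp: "c \<le> p"
    unfolding c_def using card_mono[of "{1..p}" "A \<inter> {1..p}"] by simp
  have bound: "\<bar>real (card (A \<inter> {1..N})) / real N - real c / real p\<bar> \<le> real p / real N"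
    if N: "N > 0" for N
  proof -
    define r k where "r = N mod p" and "k = N div p"
    have Nrk: "N = r + k * p" unfolding r_def k_def by simp
    have r: "r < p" unfolding r_def using p by simp
    define e where "e = card (A \<inter> {1..r})"
    have er: "e \<le> r" unfolding e_def using card_mono[of "{1..r}" "A \<inter> {1..r}"] by simp
    have cN: "card (A \<inter> {1..N}) = e + k * c"
      unfolding Nrk e_def c_def using card_periodic_shift[OF per] by simp
    have le: "real r * (real c / real p) \<le> real r * 1"
      using cp p by (intro mult_left_mono) auto
    have "real (card (A \<inter> {1..N})) - real N * (real c / real p)
        = real e - real r * (real c / real p)"
      unfolding cN using p by (simp add: Nrk field_simps)
    moreover have "\<bar>real e - real r * (real c / real p)\<bar> \<le> real p"
    proof -
      have "0 \<le> real r * (real c / real p)" by simp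
      then show ?thesis using le er r by linarith
    qed
    ultimately have "\<bar>real (card (A \<inter> {1..N})) - real N * (real c / real p)\<bar> \<le> real p" by simp
    moreover have "real (card (A \<inter> {1..N})) / real N - real c / real p
        = (real (card (A \<inter> {1..N})) - real N * (real c / real p)) / real N"
      using N by (simp add: diff_divide_distrib)
    ultimately show ?thesis by (simp only: abs_divide abs_of_nat divide_right_mono of_nat_0_le_iff)
  qed
  have "(\<lambda>N. real (card (A \<inter> {1..N})) / real N - real c / real p) \<longlonglongrightarrow> 0"
  proof (rule Lim_null_comparison)
    show "\<forall>\<^sub>F N in sequentially. norm (real (card (A \<inter> {1..N})) / real N - real c / real p)
        \<le> real p / real N"
      using eventually_gt_at_top[of 0] by eventually_elim (use bound in auto)
    show "(\<lambda>N. real p / real N) \<longlonglongrightarrow> 0" by (rule lim_const_over_n)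
  qed
  then have "has_density A (real c / real p)"
    unfolding has_density_def by (rule LIM_zero_cancel)
  then show ?thesis ..
qed

lemma mem_multiples_iff: "n \<in> multiples B \<longleftrightarrow> (\<exists>b\<in>B. \<exists>k\<ge>1. n = b * k)"
  by (auto simp: multiples_def)

lemma mem_multiples_iff_dvd:
  assumes "n \<ge> 1"
  shows "n \<in> multiples B \<longleftrightarrow> (\<exists>b\<in>B. b dvd n)"
  unfolding mem_multiples_iff dvd_def using assms by (metis Suc_le_eq One_nat_def mult_is_0 neq0_conv)

lemma multiples_mono: "B \<subseteq> C \<Longrightarrow> multiples B \<subseteq> multiples C"
  by (auto simp: multiples_def)

lemma multiples_subset_pos_nats:
  assumes "B \<subseteq> pos_nats"
  shows "multiples B \<subseteq> pos_nats"
  using assms by (fastforce simp: mem_multiples_iff)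

lemma multiples_finite_periodic:
  assumes "finite B" "B \<subseteq> pos_nats"
  obtains p where "p \<ge> 1" "\<And>n. n \<ge> 1 \<Longrightarrow> n + p \<in> multiples B \<longleftrightarrow> n \<in> multiples B"
proof
  show "\<Prod>B \<ge> 1" using assms by (intro prod_ge_1) auto
  fix n :: nat assume n: "n \<ge> 1"
  have "b dvd n + \<Prod>B \<longleftrightarrow> b dvd n" if "b \<in> B" for b
    using that assms(1) by (intro dvd_add_left_iff dvd_prodI[of B b "\<lambda>x. x", simplified])
  then show "n + \<Prod>B \<in> multiples B \<longleftrightarrow> n \<in> multiples B"
    using n by (simp add: mem_multiples_iff_dvd)
qed

section \<open>Dirichlet series of sets and the zeta distribution\<close>

definition dirichlet_sum :: "nat set \<Rightarrow> real \<Rightarrow> real" where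
  "dirichlet_sum A s = (\<Sum>n. indicator A n * real n powr - s)"

lemma summable_dirichlet_sum:
  assumes "s > 1"
  shows "summable (\<lambda>n. indicator A n * real n powr - s :: real)"
proof (rule summable_comparison_test')
  show "summable (\<lambda>n. real n powr - s)" using assms by (simp add: summable_real_powr_iff)
  show "norm (indicator A n * real n powr - s :: real) \<le> real n powr - s" if "n \<ge> 0" for n
    by (simp add: indicator_def)
qed

lemma sum_indicator_powr:
  "(\<Sum>n\<le>N. indicator A n * real n powr - s) = (\<Sum>n\<in>A \<inter> {1..N}. real n powr - s)"
proof -
  have "(\<Sum>n\<le>N. indicator A n * real n powr - s) = (\<Sum>n\<in>A \<inter> {1..N}. indicator A n * real n powr - s)"
    by (rule sum.mono_neutral_right) (auto simp: indicator_def Suc_le_eq)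
  then show ?thesis by (simp add: indicator_def)
qed

lemma dirichlet_sum_LIMSEQ:
  assumes "s > 1"
  shows "(\<lambda>N. \<Sum>n\<in>A \<inter> {1..N}. real n powr - s) \<longlonglongrightarrow> dirichlet_sum A s"
  using summable_LIMSEQ'[OF summable_dirichlet_sum[OF assms, of A]]
  unfolding dirichlet_sum_def sum_indicator_powr .

lemma partial_sum_le_dirichlet_sum:
  assumes "s > 1"
  shows "(\<Sum>n\<in>A \<inter> {1..N}. real n powr - s) \<le> dirichlet_sum A s"
  unfolding sum_indicator_powr[symmetric] dirichlet_sum_def
  by (rule sum_le_suminf[OF summable_dirichlet_sum[OF assms]]) auto

lemma zeta_pos:
  assumes "s > 1"
  shows "dirichlet_sum UNIV s > 0"
  using partial_sum_le_dirichlet_sum[OF assms, of UNIV 1] by simp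

text \<open>
  The divergence of the harmonic series: each partial sum is continuous in \<open>s\<close>, and at \<open>s = 1\<close> the
  partial sums are unbounded.
\<close>

lemma zeta_at_top: "filterlim (dirichlet_sum UNIV) at_top (at_right 1)"
  unfolding filterlim_at_top
proof
  fix Z :: real
  have "\<not> summable (\<lambda>n. real n powr - 1)" using summable_real_powr_iff[of "-1"] by simp
  then have "\<not> (\<forall>N. (\<Sum>n\<le>N. real n powr - 1) \<le> Z)"
    using bounded_imp_summable[of "\<lambda>n. real n powr - 1" Z] by auto
  then obtain N where N: "(\<Sum>n\<le>N. real n powr - 1) > Z" by (auto simp: not_le)
  have "((\<lambda>s. \<Sum>n\<le>N. real n powr - s) \<longlongrightarrow> (\<Sum>n\<le>N. real n powr - 1)) (at_right 1)"
  proof (rule tendsto_sum)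
    fix n assume "n \<in> {..N}"
    show "((\<lambda>s. real n powr - s) \<longlongrightarrow> real n powr - 1) (at_right 1)"
      by (cases "n = 0") (auto intro!: tendsto_eq_intros)
  qed
  from order_tendstoD(1)[OF this N]
  have "\<forall>\<^sub>F s in at_right 1. Z < (\<Sum>n\<le>N. real n powr - s)" .
  moreover have "\<forall>\<^sub>F s :: real in at_right 1. s > 1"
    by (simp add: eventually_at_right_less)
  ultimately show "\<forall>\<^sub>F s in at_right 1. Z \<le> dirichlet_sum UNIV s"
  proof eventually_elim
    case (elim s)
    then show ?case
      using partial_sum_le_dirichlet_sum[of s UNIV N] sum_indicator_powr[of UNIV s N] by simp
  qed
qed

section \<open>From natural density to the zeta distribution\<close>

text \<open>
  Summation by parts in inequality form: for decreasing weights, nonnegative partial sums can be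
  weighted term by term. This transfers bounds on counting functions to Dirichlet
  series, the weights being \<open>n powr - s\<close>.
\<close>

lemma weighted_sum_ge_last_weight:
  fixes x w :: "nat \<Rightarrow> real"
  assumes nonneg: "\<And>n. 0 \<le> (\<Sum>k\<in>{1..n}. x k)"
    and anti: "\<And>n. n \<ge> 1 \<Longrightarrow> w (Suc n) \<le> w n"
  shows "w n * (\<Sum>k\<in>{1..n}. x k) \<le> (\<Sum>k\<in>{1..n}. x k * w k)"
proof (induction n)
  case (Suc n)
  show ?case
  proof (cases "n = 0")
    case False
    have "w (Suc n) * (\<Sum>k\<in>{1..n}. x k) \<le> w n * (\<Sum>k\<in>{1..n}. x k)"
      using anti[of n] False nonneg by (intro mult_right_mono) auto
    then show ?thesis using Suc by (simp add: algebra_simps)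
  qed simp
qed simp

lemma weighted_sum_nonneg:
  fixes x w :: "nat \<Rightarrow> real"
  assumes "\<And>n. 0 \<le> (\<Sum>k\<in>{1..n}. x k)"
    and "\<And>n. n \<ge> 1 \<Longrightarrow> w (Suc n) \<le> w n" and "\<And>n. 0 \<le> w n"
  shows "0 \<le> (\<Sum>k\<in>{1..n}. x k * w k)"
  using weighted_sum_ge_last_weight[of x w n, OF assms(1,2)] assms(1,3)
  by (meson mult_nonneg_nonneg order_trans)

text \<open>
  The right-hand side \<open>C + e N\<close> is the summatory function of the sequence that is \<open>C + e\<close> at 1 and
  \<open>e\<close> afterwards, whose Dirichlet series is \<open>C + e \<zeta>(s)\<close>. The hypothesis therefore says that
  this sequence plus or minus \<open>indicator A - a\<close> has nonnegative partial sums, which survives the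
  weighting.
\<close>

lemma counting_bound_imp_dirichlet_bound:
  fixes a C e s :: real
  assumes s: "s > 1" and C: "C \<ge> 0"
    and bound: "\<And>N. \<bar>real (card (A \<inter> {1..N})) - a * real N\<bar> \<le> C + e * real N"
  shows "\<bar>dirichlet_sum A s - a * dirichlet_sum UNIV s\<bar> \<le> C + e * dirichlet_sum UNIV s"
proof -
  define w where "w n = real n powr - s" for n
  have w0: "w n \<ge> 0" for n by (simp add: w_def)
  have wanti: "w (Suc n) \<le> w n" if "n \<ge> 1" for n
    unfolding w_def using that s by (intro powr_mono2') auto
  have card: "(\<Sum>k\<in>{1..n}. indicator A k) = real (card (A \<inter> {1..n}))" for n
    by (simp add: indicator_def sum.If_cases Int_commute)
  have first: "(\<Sum>k\<in>{1..n}. if k = 1 then C else 0) = (if n \<ge> 1 then C else 0)" for n :: nat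
    by (simp add: sum.delta)
  \<comment> \<open>The two signs \<open>\<sigma>\<close> give the two halves of the absolute value.\<close>
  have signed: "0 \<le> C + e * (\<Sum>k\<in>{1..N}. w k)
      + \<sigma> * ((\<Sum>k\<in>A \<inter> {1..N}. w k) - a * (\<Sum>k\<in>{1..N}. w k))"
    if \<sigma>: "\<sigma> = 1 \<or> \<sigma> = -1" for \<sigma> :: real and N
  proof -
    let ?x = "\<lambda>k. (if k = 1 then C else 0) + e + \<sigma> * (indicator A k - a)"
    have partial: "(\<Sum>k\<in>{1..n}. ?x k) = (if n \<ge> 1 then C else 0) + e * real n
        + \<sigma> * (real (card (A \<inter> {1..n})) - a * real n)" for n :: nat
      by (simp only: sum.distrib first card sum_subtractf flip: sum_distrib_left) simp
    have "0 \<le> (\<Sum>k\<in>{1..n}. ?x k)" for n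
      unfolding partial using bound[of n] \<sigma> C by (cases "n = 0") (auto simp: abs_le_iff)
    from weighted_sum_nonneg[of ?x w, OF this wanti w0]
    have "0 \<le> (\<Sum>k\<in>{1..N}. ?x k * w k)" .
    also have "\<dots> = (\<Sum>k\<in>{1..N}. (if k = 1 then C * w 1 else 0) + e * w k
        + \<sigma> * (indicator A k * w k - a * w k))"
      by (intro sum.cong) (auto simp: algebra_simps)
    also have "\<dots> = (\<Sum>k\<in>{1..N}. if k = 1 then C * w 1 else 0) + e * (\<Sum>k\<in>{1..N}. w k)
        + \<sigma> * ((\<Sum>k\<in>{1..N}. indicator A k * w k) - a * (\<Sum>k\<in>{1..N}. w k))"
      by (simp only: sum.distrib sum_subtractf right_diff_distrib flip: sum_distrib_left)
    also have "(\<Sum>k\<in>{1..N}. indicator A k * w k) = (\<Sum>k\<in>A \<inter> {1..N}. w k)"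
      by (simp add: indicator_def if_distrib sum.If_cases Int_commute mult.commute cong: if_cong)
    also have "(\<Sum>k\<in>{1..N}. if k = 1 then C * w 1 else 0) \<le> C"
      using C by (simp add: sum.delta w_def)
    finally show ?thesis by simp
  qed
  have limA: "(\<lambda>N. \<Sum>k\<in>A \<inter> {1..N}. w k) \<longlonglongrightarrow> dirichlet_sum A s"
    unfolding w_def by (rule dirichlet_sum_LIMSEQ[OF s])
  have limU: "(\<lambda>N. \<Sum>k\<in>{1..N}. w k) \<longlonglongrightarrow> dirichlet_sum UNIV s"
    unfolding w_def using dirichlet_sum_LIMSEQ[OF s, of UNIV] by simp
  have "0 \<le> C + e * dirichlet_sum UNIV s + \<sigma> * (dirichlet_sum A s - a * dirichlet_sum UNIV s)"
    if "\<sigma> = 1 \<or> \<sigma> = -1" for \<sigma> :: real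
    by (rule LIMSEQ_le_const[OF tendsto_add[OF tendsto_add[OF tendsto_const
            tendsto_mult[OF tendsto_const limU]]
          tendsto_mult[OF tendsto_const tendsto_diff[OF limA
            tendsto_mult[OF tendsto_const limU]]]]])
       (use signed[OF that] in auto)
  from this[of 1] this[of "-1"] show ?thesis by (simp add: abs_le_iff)
qed

text \<open>
  The Abelian half of the comparison of densities. The counting error is at most \<open>C + e N\<close>,
  with \<open>C\<close> absorbing the finitely many \<open>N\<close> at which the average is not yet close to \<open>a\<close>. After
  division by \<open>\<zeta>(s)\<close> only \<open>e\<close> survives, because \<open>\<zeta>(s)\<close> tends to infinity.
\<close>

lemma density_imp_zeta_density:
  assumes dens: "has_density A a"
  shows "((\<lambda>s. dirichlet_sum A s / dirichlet_sum UNIV s) \<longlongrightarrow> a) (at_right 1)"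
proof (rule tendstoI)
  fix \<epsilon> :: real assume \<epsilon>: "\<epsilon> > 0"
  define e where "e = \<epsilon> / 2"
  have e: "e > 0" using \<epsilon> by (simp add: e_def)
  obtain N0 where N0: "\<And>N. N \<ge> N0 \<Longrightarrow> \<bar>real (card (A \<inter> {1..N})) / real N - a\<bar> < e"
    using LIMSEQ_D[OF dens[unfolded has_density_def] e] by (auto simp: real_norm_def)
  define C where "C = (1 + \<bar>a\<bar>) * real N0"
  have C: "C \<ge> 0" by (simp add: C_def)
  have bound: "\<bar>real (card (A \<inter> {1..N})) - a * real N\<bar> \<le> C + e * real N" for N
  proof (cases "N \<ge> N0 \<and> N > 0")
    case True
    then have "real (card (A \<inter> {1..N})) - a * real N
        = (real (card (A \<inter> {1..N})) / real N - a) * real N" by (simp add: field_simps)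
    then have "\<bar>real (card (A \<inter> {1..N})) - a * real N\<bar>
        = \<bar>real (card (A \<inter> {1..N})) / real N - a\<bar> * real N" by (simp add: abs_mult)
    also have "\<dots> \<le> e * real N" using N0[of N] True by (intro mult_right_mono) auto
    finally show ?thesis using C by simp
  next
    case False
    then have N: "N \<le> N0" by auto
    have "card (A \<inter> {1..N}) \<le> N" using card_mono[of "{1..N}" "A \<inter> {1..N}"] by simp
    then have "\<bar>real (card (A \<inter> {1..N}))\<bar> + \<bar>a * real N\<bar> \<le> real N + \<bar>a\<bar> * real N"
      by (simp add: abs_mult)
    also have "\<dots> = (1 + \<bar>a\<bar>) * real N" by (simp add: algebra_simps)
    also have "\<dots> \<le> C" unfolding C_def using N by (intro mult_left_mono) auto
    finally have "\<bar>real (card (A \<inter> {1..N})) - a * real N\<bar> \<le> C" by linarith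
    then show ?thesis using e by (simp add: add_increasing2)
  qed
  have "\<forall>\<^sub>F s in at_right 1. C / e < dirichlet_sum UNIV s"
    using zeta_at_top by (simp add: filterlim_at_top_dense)
  moreover have "\<forall>\<^sub>F s :: real in at_right 1. s > 1"
    by (simp add: eventually_at_right_less)
  ultimately show "\<forall>\<^sub>F s in at_right 1.
      dist (dirichlet_sum A s / dirichlet_sum UNIV s) a < \<epsilon>"
  proof eventually_elim
    case (elim s)
    let ?z = "dirichlet_sum UNIV s"
    have z: "?z > 0" using elim zeta_pos by simp
    have "\<bar>dirichlet_sum A s - a * ?z\<bar> \<le> C + e * ?z"
      using counting_bound_imp_dirichlet_bound[OF _ C bound] elim by simp
    also have "\<dots> < \<epsilon> * ?z"
      using elim e by (simp add: e_def field_simps)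
    finally have "\<bar>dirichlet_sum A s - a * ?z\<bar> / ?z < \<epsilon>" using z by (simp add: field_simps)
    moreover have "dirichlet_sum A s / ?z - a = (dirichlet_sum A s - a * ?z) / ?z"
      using z by (simp add: field_simps)
    ultimately show ?case using z by (simp add: dist_real_def abs_divide)
  qed
qed

section \<open>Monotonicity of the zeta distribution on sets of multiples\<close>

lemma divisors_prime_power_mult:
  fixes p :: nat
  assumes p: "prime p" and m: "\<not> p dvd m" "m > 0"
  shows "bij_betw (\<lambda>(i, c). p ^ i * c) ({..k} \<times> {c. c dvd m}) {b. b dvd p ^ k * m}"
proof (rule bij_betwI')
  fix x y assume "x \<in> {..k} \<times> {c. c dvd m}" "y \<in> {..k} \<times> {c. c dvd m}"
  then obtain i c j d where xy: "x = (i, c)" "y = (j, d)" "c dvd m" "d dvd m" by auto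
  have nd: "\<not> p dvd c" "\<not> p dvd d" using m xy dvd_trans by blast+
  have "i = j \<and> c = d" if eq: "p ^ i * c = p ^ j * d"
  proof -
    have *: "multiplicity p (p ^ l * e) = l" if "\<not> p dvd e" for l e
      using that p by (intro multiplicity_eqI) (auto simp: prime_gt_0_nat mult.commute)
    have "i = j" using *[OF nd(1), of i] *[OF nd(2), of j] eq by simp
    then show ?thesis using eq p by (simp add: prime_gt_0_nat)
  qed
  then show "((\<lambda>(i, c). p ^ i * c) x = (\<lambda>(i, c). p ^ i * c) y) = (x = y)"
    using xy by auto
next
  fix x assume "x \<in> {..k} \<times> {c. c dvd m}"
  then show "(\<lambda>(i, c). p ^ i * c) x \<in> {b. b dvd p ^ k * m}"
    by (auto intro!: mult_dvd_mono le_imp_power_dvd)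
next
  fix b assume "b \<in> {b. b dvd p ^ k * m}"
  then obtain x c where xc: "b = x * c" "x dvd p ^ k" "c dvd m"
    using division_decomp by blast
  then obtain i where "i \<le> k" "x = p ^ i" using divides_primepow_nat[OF p] by blast
  then show "\<exists>x\<in>{..k} \<times> {c. c dvd m}. b = (\<lambda>(i, c). p ^ i * c) x"
    using xc by (intro bexI[of _ "(i, c)"]) auto
qed

text \<open>
  Jordan's totient function with a real exponent. Its Dirichlet series is \<open>\<zeta>(s - t) / \<zeta>(s)\<close>; it
  supplies the law of the random factor that turns a \<open>P\<^sub>s\<close>-random integer into a
  \<open>P\<^bsub>s - t\<^esub>\<close>-random one.
\<close>

definition jordan_totient :: "real \<Rightarrow> nat \<Rightarrow> real" where
  "jordan_totient t n = real n powr t * (\<Prod>p\<in>prime_factors n. 1 - real p powr - t)"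

lemma jordan_totient_nonneg:
  assumes "t \<ge> 0"
  shows "jordan_totient t n \<ge> 0"
proof -
  have "real p powr - t \<le> 1" if "p \<in> prime_factors n" for p
    using that assms in_prime_factors_imp_prime[OF that]
    by (simp add: powr_minus inverse_le_1_iff ge_one_powr_ge_zero prime_gt_0_nat Suc_leI)
  then show ?thesis
    unfolding jordan_totient_def by (intro mult_nonneg_nonneg prod_nonneg) auto
qed

lemma jordan_totient_prime_power_mult:
  fixes p :: nat
  assumes p: "prime p" and c: "\<not> p dvd c" "c > 0"
  shows "jordan_totient t (p ^ i * c) =
    (if i = 0 then 1 else (real p powr t) ^ i - (real p powr t) ^ (i - 1)) * jordan_totient t c"
proof (cases "i = 0")
  case False
  have p0: "p > 0" using p by (simp add: prime_gt_0_nat)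
  have pf: "prime_factors (p ^ i * c) = insert p (prime_factors c)"
    using False p c p0
    by (auto simp: in_prime_factors_iff prime_dvd_mult_iff prime_dvd_power_iff primes_dvd_imp_eq)
  have pin: "p \<notin> prime_factors c" using c by auto
  have "real (p ^ i * c) powr t = (real p powr t) ^ i * real c powr t"
    by (simp add: powr_mult powr_powr powr_realpow[symmetric] p0 mult.commute)
  moreover have "(real p powr t) ^ i * (1 - real p powr - t)
      = (real p powr t) ^ i - (real p powr t) ^ (i - 1)"
    using False p0 by (cases i) (auto simp: powr_minus field_simps)
  ultimately show ?thesis
    using False pin unfolding jordan_totient_def pf by (simp add: mult_ac)
qed simp

text \<open>
  Both sides are multiplicative, so one prime power \<open>p ^ k\<close> is split off at a time; there the
  sum telescopes to \<open>(real p powr t) ^ k\<close>.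
\<close>

lemma sum_jordan_totient_divisors:
  assumes "n > 0"
  shows "(\<Sum>b | b dvd n. jordan_totient t b) = real n powr t"
  using assms
proof (induction n rule: less_induct)
  case (less n)
  show ?case
  proof (cases "n = 1")
    case True
    then show ?thesis by (simp add: jordan_totient_def)
  next
    case False
    then obtain p where p: "prime p" "p dvd n" using prime_factor_nat by blast
    have p1: "p > 1" using p prime_gt_1_nat by simp
    obtain m where m: "n = p ^ multiplicity p n * m" "\<not> p dvd m"
      using multiplicity_decompose'[of n p] less.prems p p1 by (metis less_irrefl neq0_conv nat_dvd_1_iff_1)
    define k where "k = multiplicity p n"
    have nk: "n = p ^ k * m" using m(1) by (simp add: k_def)
    have k: "k > 0" using p less.prems unfolding k_def by (simp add: prime_multiplicity_gt_zero_iff)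
    have m0: "m > 0" using nk less.prems by (cases m) auto
    have mn: "m < n"
      unfolding nk using m0 one_less_power[OF p1 k] by simp
    define q where "q = real p powr t"
    let ?h = "\<lambda>i. if i = 0 then 1 else q ^ i - q ^ (i - 1)"
    have telescope: "(\<Sum>i\<le>l. ?h i) = q ^ l" for l by (induction l) auto
    have "(\<Sum>b | b dvd n. jordan_totient t b)
        = (\<Sum>(i, c)\<in>{..k} \<times> {c. c dvd m}. jordan_totient t (p ^ i * c))"
      unfolding nk
      using sum.reindex_bij_betw[OF divisors_prime_power_mult[OF p(1) m(2) m0], of "jordan_totient t" k]
      by (simp add: case_prod_unfold)
    also have "\<dots> = (\<Sum>(i, c)\<in>{..k} \<times> {c. c dvd m}. ?h i * jordan_totient t c)"
    proof (intro sum.cong refl, clarify)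
      fix i c assume "c dvd m"
      then have "\<not> p dvd c" "c > 0" using m(2) m0 dvd_trans dvd_pos_nat by blast+
      then show "jordan_totient t (p ^ i * c) = ?h i * jordan_totient t c"
        unfolding q_def using jordan_totient_prime_power_mult[OF p(1)] by blast
    qed
    also have "\<dots> = (\<Sum>i\<le>k. ?h i) * (\<Sum>c | c dvd m. jordan_totient t c)"
      by (simp add: sum_product sum.cartesian_product)
    also have "\<dots> = q ^ k * real m powr t" using telescope less.IH[OF mn m0] by simp
    also have "\<dots> = real n powr t"
      using p1 by (simp add: nk q_def powr_mult powr_powr powr_realpow[symmetric] mult.commute)
    finally show ?thesis .
  qed
qed

text \<open>
  The divisor sum of Jordan's totient yields the convolution identity
  \<open>real n powr - u = (\<Sum>b | b dvd n. w n * f b)\<close> with \<open>f \<ge> 0\<close> and the completely multiplicative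
  weight \<open>w n = real n powr - s\<close>. Summation over all \<open>n\<close> gives \<open>\<zeta>(u) \<le> \<zeta>(s) G\<close>, where \<open>G\<close> is the
  Dirichlet series of \<open>f\<close> at \<open>s\<close>. Summation over \<open>n \<in> M\<close>, keeping only the factorizations
  \<open>n = a * b\<close> with \<open>a \<in> M\<close>, gives \<open>P\<^sub>s(M) \<zeta>(s) G \<le> P\<^sub>u(M) \<zeta>(u)\<close>; here the closure of \<open>M\<close> under
  multiples ensures that every such product lies in \<open>M\<close>. Multiplying the two eliminates \<open>G\<close>. The
  truncations at \<open>N\<close> keep all double sums finite.
\<close>

lemma zeta_distribution_antimono:
  assumes s: "1 < u" "u \<le> s"
    and up: "\<And>a b. a \<in> M \<Longrightarrow> b \<ge> 1 \<Longrightarrow> a * b \<in> M"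
  shows "dirichlet_sum M s / dirichlet_sum UNIV s \<le> dirichlet_sum M u / dirichlet_sum UNIV u"
proof -
  have s1: "s > 1" using s by simp
  define w where "w n = real n powr - s" for n
  define f where "f = jordan_totient (s - u)"
  have w0: "w n \<ge> 0" for n by (simp add: w_def)
  have f0: "f n \<ge> 0" for n using jordan_totient_nonneg s by (simp add: f_def)
  have wmult: "w (a * b) = w a * w b" for a b by (simp add: w_def powr_mult)
  have conv: "real n powr - u = (\<Sum>b | b dvd n. w n * f b)" if "n > 0" for n
    using sum_jordan_totient_divisors[OF that, of "s - u"] that
    by (simp add: f_def w_def flip: sum_distrib_left powr_add)
  define G where "G N = (\<Sum>b\<in>{1..N}. w b * f b)" for N
  have G0: "G N \<ge> 0" for N unfolding G_def by (intro sum_nonneg mult_nonneg_nonneg w0 f0)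
  have upper: "(\<Sum>n\<in>{1..N}. real n powr - u) \<le> dirichlet_sum UNIV s * G N" for N
  proof -
    let ?S = "SIGMA n:{1..N}. {b. b dvd n}"
    have "(\<Sum>n\<in>{1..N}. real n powr - u) = (\<Sum>n\<in>{1..N}. \<Sum>b | b dvd n. w n * f b)"
      using conv by (intro sum.cong) auto
    also have "\<dots> = (\<Sum>(n, b)\<in>?S. w n * f b)" by (intro sum.Sigma) auto
    also have "\<dots> \<le> (\<Sum>(a, b)\<in>{1..N} \<times> {1..N}. w a * (w b * f b))"
    proof (rule sum_le_included[where i = "\<lambda>(a, b). (a * b, b)"])
      show "\<forall>x\<in>?S. \<exists>y\<in>{1..N} \<times> {1..N}. (case y of (a, b) \<Rightarrow> (a * b, b)) = x \<and>
        (case x of (n, b) \<Rightarrow> w n * f b) \<le> (case y of (a, b) \<Rightarrow> w a * (w b * f b))"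
      proof clarify
        fix n b assume nb: "n \<in> {1..N}" "b dvd n"
        then obtain a where a: "n = a * b" by (metis dvd_def mult.commute)
        with nb have ab: "1 \<le> a" "1 \<le> b" by auto
        then have "a \<le> a * b" "b \<le> a * b" by auto
        moreover have "a * b \<le> N" using a nb by auto
        ultimately have "a \<in> {1..N}" "b \<in> {1..N}" using ab by (meson atLeastAtMost_iff le_trans)+
        then show "\<exists>y\<in>{1..N} \<times> {1..N}. (case y of (a, b) \<Rightarrow> (a * b, b)) = (n, b) \<and>
            w n * f b \<le> (case y of (a, b) \<Rightarrow> w a * (w b * f b))"
          using a by (intro bexI[of _ "(a, b)"]) (auto simp: wmult mult_ac)
      qed
    qed (auto simp: w0 f0)
    also have "\<dots> = (\<Sum>a\<in>{1..N}. w a) * G N"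
      by (simp add: G_def sum_product sum.cartesian_product)
    also have "\<dots> \<le> dirichlet_sum UNIV s * G N"
      using partial_sum_le_dirichlet_sum[OF s1, of UNIV N] G0
      by (intro mult_right_mono) (auto simp: w_def)
    finally show ?thesis .
  qed
  have lower: "(\<Sum>a\<in>M \<inter> {1..N}. w a) * G N \<le> dirichlet_sum M u" for N
  proof -
    \<comment> \<open>The products of two factors up to \<open>N\<close> range up to \<open>N * N\<close>.\<close>
    let ?S = "SIGMA n:M \<inter> {1..N * N}. {b. b dvd n}"
    have "(\<Sum>a\<in>M \<inter> {1..N}. w a) * G N
        = (\<Sum>(a, b)\<in>(M \<inter> {1..N}) \<times> {1..N}. w a * (w b * f b))"
      by (simp add: G_def sum_product sum.cartesian_product)
    also have "\<dots> \<le> (\<Sum>(n, b)\<in>?S. w n * f b)"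
    proof (rule sum_le_included[where i = "\<lambda>(n, b). (n div b, b)"])
      show "\<forall>x\<in>(M \<inter> {1..N}) \<times> {1..N}. \<exists>y\<in>?S. (case y of (n, b) \<Rightarrow> (n div b, b)) = x \<and>
        (case x of (a, b) \<Rightarrow> w a * (w b * f b)) \<le> (case y of (n, b) \<Rightarrow> w n * f b)"
      proof clarify
        fix a b assume ab: "a \<in> M" "a \<in> {1..N}" "b \<in> {1..N}"
        then have "(a * b, b) \<in> ?S" using up[of a b] by (auto intro: mult_le_mono)
        then show "\<exists>y\<in>?S. (case y of (n, b) \<Rightarrow> (n div b, b)) = (a, b) \<and>
            w a * (w b * f b) \<le> (case y of (n, b) \<Rightarrow> w n * f b)"
          using ab by (intro bexI[of _ "(a * b, b)"]) (auto simp: wmult mult_ac)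
      qed
    qed (auto simp: w0 f0 intro!: finite_SigmaI)
    also have "\<dots> = (\<Sum>n\<in>M \<inter> {1..N * N}. \<Sum>b | b dvd n. w n * f b)"
      by (intro sum.Sigma[symmetric]) auto
    also have "\<dots> = (\<Sum>n\<in>M \<inter> {1..N * N}. real n powr - u)"
      using conv by (intro sum.cong) auto
    also have "\<dots> \<le> dirichlet_sum M u" using s by (intro partial_sum_le_dirichlet_sum)
    finally show ?thesis .
  qed
  have "(\<Sum>a\<in>M \<inter> {1..N}. w a) * (\<Sum>n\<in>{1..N}. real n powr - u)
      \<le> dirichlet_sum UNIV s * dirichlet_sum M u" for N
  proof -
    have "(\<Sum>a\<in>M \<inter> {1..N}. w a) * (\<Sum>n\<in>{1..N}. real n powr - u)
        \<le> (\<Sum>a\<in>M \<inter> {1..N}. w a) * (dirichlet_sum UNIV s * G N)"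
      by (intro mult_left_mono upper sum_nonneg w0)
    also have "\<dots> = dirichlet_sum UNIV s * ((\<Sum>a\<in>M \<inter> {1..N}. w a) * G N)" by simp
    also have "\<dots> \<le> dirichlet_sum UNIV s * dirichlet_sum M u"
      using zeta_pos[OF s1] by (intro mult_left_mono lower) auto
    finally show ?thesis .
  qed
  moreover have "(\<lambda>N. (\<Sum>a\<in>M \<inter> {1..N}. w a) * (\<Sum>n\<in>{1..N}. real n powr - u))
      \<longlonglongrightarrow> dirichlet_sum M s * dirichlet_sum UNIV u"
    using dirichlet_sum_LIMSEQ[OF s1, of M] dirichlet_sum_LIMSEQ[OF s(1), of UNIV]
    unfolding w_def by (intro tendsto_mult) auto
  ultimately have "dirichlet_sum M s * dirichlet_sum UNIV u
      \<le> dirichlet_sum UNIV s * dirichlet_sum M u"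
    by (intro LIMSEQ_le_const2) auto
  then show ?thesis using zeta_pos[OF s1] zeta_pos[OF s(1)] by (simp add: field_simps)
qed

section \<open>The Davenport-Erdos theorem\<close>

text \<open>
  By monotonicity \<open>P\<^sub>s\<close> of a set of multiples is at most its limit as \<open>s\<close> decreases to 1, which is the
  density.
\<close>

lemma dirichlet_sum_multiples_le_density:
  assumes dens: "has_density (multiples B) a" and s: "s > 1"
  shows "dirichlet_sum (multiples B) s \<le> a * dirichlet_sum UNIV s"
proof -
  let ?P = "\<lambda>u. dirichlet_sum (multiples B) u / dirichlet_sum UNIV u"
  have up: "x * k \<in> multiples B" if "x \<in> multiples B" "k \<ge> 1" for x k
  proof -
    obtain b l where "b \<in> B" "l \<ge> 1" "x = b * l"
      using \<open>x \<in> multiples B\<close> by (auto simp: mem_multiples_iff)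
    then show ?thesis
      using \<open>k \<ge> 1\<close> unfolding mem_multiples_iff
      by (intro bexI[of _ b] exI[of _ "l * k"]) (auto simp: Suc_le_eq)
  qed
  have "\<forall>\<^sub>F u in at_right 1. u \<in> {1<..<s}"
    using s by (rule eventually_at_right_real)
  then have "\<forall>\<^sub>F u in at_right 1. ?P s \<le> ?P u"
    by eventually_elim (use zeta_distribution_antimono[OF _ _ up] in auto)
  then have "?P s \<le> a"
    by (intro tendsto_lowerbound[OF density_imp_zeta_density[OF dens]]) auto
  then show ?thesis using zeta_pos[OF s] by (simp add: field_simps)
qed

text \<open>
  The bound \<open>\<theta>\<close> on the densities of the truncations bounds \<open>P\<^sub>s\<close> of each truncation, uniformly in \<open>s\<close>.
  Up to \<open>N\<close> the multiples of \<open>B\<close> are those of \<open>B \<inter> {..N}\<close>, so the bound passes to the partial sums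
  for \<open>multiples B\<close>, then to \<open>P\<^sub>s (multiples B)\<close>, and finally to the density as \<open>s\<close> decreases to 1.
\<close>

lemma Davenport_Erdos_density_le:
  assumes dens: "has_density (multiples B) a"
    and trunc: "\<And>K. \<exists>c\<le>\<theta>. has_density (multiples (B \<inter> {..K})) c"
  shows "a \<le> \<theta>"
proof -
  have "dirichlet_sum (multiples B) s / dirichlet_sum UNIV s \<le> \<theta>" if s: "s > 1" for s
  proof -
    have "(\<Sum>n\<in>multiples B \<inter> {1..N}. real n powr - s) \<le> \<theta> * dirichlet_sum UNIV s" for N
    proof -
      obtain c where c: "c \<le> \<theta>" "has_density (multiples (B \<inter> {..N})) c" using trunc by blast
      have "multiples B \<inter> {1..N} \<subseteq> multiples (B \<inter> {..N}) \<inter> {1..N}"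
      proof
        fix n assume n: "n \<in> multiples B \<inter> {1..N}"
        then obtain b where "b \<in> B" "b dvd n" by (auto simp: mem_multiples_iff_dvd)
        moreover from this n have "b \<le> N" by (auto dest: dvd_imp_le)
        ultimately show "n \<in> multiples (B \<inter> {..N}) \<inter> {1..N}"
          using n by (auto simp: mem_multiples_iff_dvd)
      qed
      then have "(\<Sum>n\<in>multiples B \<inter> {1..N}. real n powr - s)
          \<le> (\<Sum>n\<in>multiples (B \<inter> {..N}) \<inter> {1..N}. real n powr - s)"
        by (intro sum_mono2) auto
      also have "\<dots> \<le> dirichlet_sum (multiples (B \<inter> {..N})) s"
        by (rule partial_sum_le_dirichlet_sum[OF s])
      also have "\<dots> \<le> c * dirichlet_sum UNIV s"
        by (rule dirichlet_sum_multiples_le_density[OF c(2) s])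
      also have "\<dots> \<le> \<theta> * dirichlet_sum UNIV s"
        using c(1) zeta_pos[OF s] by (intro mult_right_mono) auto
      finally show ?thesis .
    qed
    then have "dirichlet_sum (multiples B) s \<le> \<theta> * dirichlet_sum UNIV s"
      by (intro LIMSEQ_le_const2[OF dirichlet_sum_LIMSEQ[OF s]]) auto
    then show ?thesis using zeta_pos[OF s] by (simp add: field_simps)
  qed
  moreover have "\<forall>\<^sub>F s :: real in at_right 1. s > 1"
    by (simp add: eventually_at_right_less)
  ultimately have "\<forall>\<^sub>F s in at_right 1. dirichlet_sum (multiples B) s / dirichlet_sum UNIV s \<le> \<theta>"
    by (auto elim: eventually_mono)
  then show ?thesis
    by (intro tendsto_upperbound[OF density_imp_zeta_density[OF dens]]) auto
qed

section \<open>Rational sets\<close>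

text \<open>
  The averages of \<open>R\<close> are eventually within \<open>\<epsilon> / 4\<close> of those of an approximating periodic
  set, which in turn are eventually within \<open>\<epsilon> / 4\<close> of their limit. Thus the averages of \<open>R\<close> are
  Cauchy.
\<close>

lemma rational_set_imp_density:
  assumes "rational_set R"
  shows "\<exists>d. has_density R d"
proof -
  define x where "x N = real (card (R \<inter> {1..N})) / real N" for N
  have "Cauchy x"
  proof (rule metric_CauchyI)
    fix \<epsilon> :: real assume \<epsilon>: "\<epsilon> > 0"
    then obtain y where y: "y \<in> binary_seqs" "periodic_seq y"
      "besicovitch_dist (indicator R) y < ereal (\<epsilon> / 4)"
      using assms unfolding rational_set_def by (metis zero_less_divide_iff zero_less_numeral)
    define A where "A = {n. y n = 1}"
    obtain p where p: "p \<ge> 1" "\<forall>n\<in>pos_nats. y (n + p) = y n"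
      using y(2) unfolding periodic_seq_def by blast
    have "\<exists>d. has_density A d"
      by (rule periodic_has_density[OF p(1)]) (use p(2) in \<open>auto simp: A_def\<close>)
    then obtain d where d: "(\<lambda>N. real (card (A \<inter> {1..N})) / real N) \<longlonglongrightarrow> d"
      unfolding has_density_def by blast
    have "\<forall>\<^sub>F N in sequentially.
        ereal (real (card {n \<in> {1..N}. indicator R n \<noteq> y n}) / real N) < ereal (\<epsilon> / 4)"
      using y(3) unfolding besicovitch_dist_def by (rule Limsup_lessD)
    moreover have "\<forall>\<^sub>F N in sequentially. dist (real (card (A \<inter> {1..N})) / real N) d < \<epsilon> / 4"
      using tendstoD[OF d, of "\<epsilon> / 4"] \<epsilon> by simp
    ultimately have "\<forall>\<^sub>F N in sequentially. dist (x N) d < \<epsilon> / 2"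
      using eventually_gt_at_top[of 0]
    proof eventually_elim
      case (elim N)
      let ?D = "{n \<in> {1..N}. indicator R n \<noteq> y n}"
      have val: "y n = 0 \<or> y n = 1" if "n \<ge> 1" for n
        using y(1) that unfolding binary_seqs_def by auto
      have "R \<inter> {1..N} \<subseteq> (A \<inter> {1..N}) \<union> ?D" "A \<inter> {1..N} \<subseteq> (R \<inter> {1..N}) \<union> ?D"
        using val by (auto simp: A_def indicator_def)
      then have "card (R \<inter> {1..N}) \<le> card (A \<inter> {1..N}) + card ?D"
        "card (A \<inter> {1..N}) \<le> card (R \<inter> {1..N}) + card ?D"
        by (auto intro!: order_trans[OF card_mono card_Un_le] simp del: One_nat_def)
      then have "\<bar>real (card (R \<inter> {1..N})) - real (card (A \<inter> {1..N}))\<bar> \<le> real (card ?D)" by linarith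
      then have "\<bar>real (card (R \<inter> {1..N})) - real (card (A \<inter> {1..N}))\<bar> / real N
          \<le> real (card ?D) / real N" by (intro divide_right_mono) auto
      then have "\<bar>x N - real (card (A \<inter> {1..N})) / real N\<bar> \<le> real (card ?D) / real N"
        by (simp add: x_def abs_divide flip: diff_divide_distrib)
      moreover have "real (card ?D) / real N < \<epsilon> / 4" using elim(1) by simp
      moreover have "\<bar>real (card (A \<inter> {1..N})) / real N - d\<bar> < \<epsilon> / 4"
        using elim(2) by (simp only: dist_real_def)
      ultimately show ?case unfolding dist_real_def by argo
    qed
    then obtain n0 where n0: "\<And>N. N \<ge> n0 \<Longrightarrow> dist (x N) d < \<epsilon> / 2"
      unfolding eventually_sequentially by blast
    have "dist (x m) (x n) < \<epsilon>" if "m \<ge> n0" "n \<ge> n0" for m n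
      using dist_triangle_half_l[OF n0[OF that(1)] n0[OF that(2)]] .
    then show "\<exists>M. \<forall>m\<ge>M. \<forall>n\<ge>M. dist (x m) (x n) < \<epsilon>" by blast
  qed
  then show ?thesis
    unfolding has_density_def x_def[symmetric] by (simp add: Cauchy_convergent_iff convergent_def)
qed

lemma rational_setI:
  assumes R: "R \<subseteq> pos_nats"
    and approx: "\<And>\<epsilon>. \<epsilon> > 0 \<Longrightarrow> \<exists>A p e. p \<ge> 1 \<and> (\<forall>n\<ge>1. n + p \<in> A \<longleftrightarrow> n \<in> A) \<and>
      e < \<epsilon> \<and> has_density {n. n \<in> R \<longleftrightarrow> n \<notin> A} e"
  shows "rational_set R"
  unfolding rational_set_def
proof (intro conjI allI impI R)
  fix \<epsilon> :: real assume "\<epsilon> > 0"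
  from approx[OF this] obtain A p e where A: "p \<ge> 1" "\<And>n. n \<ge> 1 \<Longrightarrow> n + p \<in> A \<longleftrightarrow> n \<in> A"
    and e: "e < \<epsilon>" "has_density {n. n \<in> R \<longleftrightarrow> n \<notin> A} e"
    by auto
  let ?y = "indicator A :: nat \<Rightarrow> nat"
  have "{n \<in> {1..N}. indicator R n \<noteq> ?y n} = {n. n \<in> R \<longleftrightarrow> n \<notin> A} \<inter> {1..N}" for N
    by (auto simp: indicator_def split: if_splits)
  then have "(\<lambda>N. real (card {n \<in> {1..N}. indicator R n \<noteq> ?y n}) / real N) \<longlonglongrightarrow> e"
    using e(2) unfolding has_density_def by simp
  then have "besicovitch_dist (indicator R) ?y = ereal e"
    unfolding besicovitch_dist_def by (intro lim_imp_Limsup) auto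
  moreover have "?y \<in> binary_seqs" by (auto simp: binary_seqs_def indicator_def)
  moreover have "periodic_seq ?y"
    unfolding periodic_seq_def using A by (intro exI[of _ p]) (auto simp: indicator_def)
  ultimately show "\<exists>y\<in>binary_seqs. periodic_seq y \<and> besicovitch_dist (indicator R) y < ereal \<epsilon>"
    using e(1) by (intro bexI[of _ ?y]) auto
qed

text \<open>
  If every truncation of \<open>B\<close> had density at most \<open>a - \<epsilon>\<close>, so would \<open>multiples B\<close>, whose density is
  \<open>a\<close>. Hence some truncation misses a set of multiples of density below \<open>\<epsilon>\<close>.
\<close>

lemma Besicovitch_imp_periodic_approximation:
  assumes B: "B \<subseteq> pos_nats" and dens: "has_density (multiples B) a" and \<epsilon>: "\<epsilon> > 0"
  obtains C e where "C \<subseteq> B" "finite C" "e < \<epsilon>" "has_density (multiples B - multiples C) e"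
proof -
  let ?B = "\<lambda>K. B \<inter> {..K}"
  have ex: "\<exists>c. has_density (multiples (?B K)) c" for K
  proof -
    obtain p where "p \<ge> 1" "\<And>n. n \<ge> 1 \<Longrightarrow> n + p \<in> multiples (?B K) \<longleftrightarrow> n \<in> multiples (?B K)"
      using multiples_finite_periodic[of "?B K"] B by blast
    then show ?thesis using periodic_has_density by blast
  qed
  obtain K c where K: "has_density (multiples (?B K)) c" "a - \<epsilon> < c"
  proof (rule ccontr)
    assume "\<not> thesis"
    then have "\<exists>c\<le>a - \<epsilon>. has_density (multiples (?B K)) c" for K
      using ex[of K] that by (meson not_le)
    from Davenport_Erdos_density_le[OF dens this] show False using \<epsilon> by simp
  qed
  have "has_density (multiples B - multiples (?B K)) (a - c)"
  proof -
    have sub: "multiples (?B K) \<subseteq> multiples B" by (rule multiples_mono) auto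
    have "real (card ((multiples B - multiples (?B K)) \<inter> {1..N}))
        = real (card (multiples B \<inter> {1..N})) - real (card (multiples (?B K) \<inter> {1..N}))" for N
    proof -
      have "(multiples B - multiples (?B K)) \<inter> {1..N}
          = multiples B \<inter> {1..N} - multiples (?B K) \<inter> {1..N}" by auto
      moreover have "multiples (?B K) \<inter> {1..N} \<subseteq> multiples B \<inter> {1..N}" using sub by auto
      ultimately show ?thesis
        by (simp add: card_Diff_subset card_mono of_nat_diff)
    qed
    then show ?thesis
      using tendsto_diff[OF dens[unfolded has_density_def] K(1)[unfolded has_density_def]]
      unfolding has_density_def by (simp add: diff_divide_distrib)
  qed
  then show thesis using K(2) by (intro that[of "?B K" "a - c"]) auto
qed

theorem corollary2p16:
  fixes B :: "nat set"
  assumes "B \<subseteq> pos_nats - {1}"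
  shows "rational_set (multiples B) \<and> rational_set (free_numbers B) \<longleftrightarrow> Besicovitch B"
proof
  assume "rational_set (multiples B) \<and> rational_set (free_numbers B)"
  then show "Besicovitch B"
    unfolding Besicovitch_def by (elim conjE) (rule rational_set_imp_density)
next
  assume "Besicovitch B"
  then obtain a where dens: "has_density (multiples B) a" unfolding Besicovitch_def ..
  have B: "B \<subseteq> pos_nats" using assms by auto
  have "rational_set R" if R: "R = multiples B \<or> R = free_numbers B" for R
  proof (rule rational_setI)
    show "R \<subseteq> pos_nats"
      using R multiples_subset_pos_nats[OF B] by (auto simp: free_numbers_def)
    fix \<epsilon> :: real assume \<epsilon>: "\<epsilon> > 0"
    obtain C e where C: "C \<subseteq> B" "finite C" "e < \<epsilon>" "has_density (multiples B - multiples C) e"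
      by (rule Besicovitch_imp_periodic_approximation[OF B dens \<epsilon>])
    have CB: "multiples C \<subseteq> multiples B" by (rule multiples_mono[OF C(1)])
    obtain p where p: "p \<ge> 1" "\<And>n. n \<ge> 1 \<Longrightarrow> n + p \<in> multiples C \<longleftrightarrow> n \<in> multiples C"
      using multiples_finite_periodic[OF C(2)] C(1) B by blast
    obtain A where A: "R = multiples B \<and> A = multiples C \<or> R = free_numbers B \<and> A = free_numbers C"
      using R by blast
    \<comment> \<open>Taking complements leaves the symmetric difference unchanged on the positive integers.\<close>
    have "{n. n \<in> R \<longleftrightarrow> n \<notin> A} \<inter> {1..N} = (multiples B - multiples C) \<inter> {1..N}" for N
      using A CB by (auto simp: free_numbers_def)
    then have "has_density {n. n \<in> R \<longleftrightarrow> n \<notin> A} e"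
      using C(4) unfolding has_density_def by simp
    moreover have "\<forall>n\<ge>1. n + p \<in> A \<longleftrightarrow> n \<in> A"
      using A p by (auto simp: free_numbers_def)
    ultimately show "\<exists>A p e. p \<ge> 1 \<and> (\<forall>n\<ge>1. n + p \<in> A \<longleftrightarrow> n \<in> A) \<and> e < \<epsilon> \<and>
        has_density {n. n \<in> R \<longleftrightarrow> n \<notin> A} e"
      using p(1) C(3) by (intro exI conjI)
  qed
  then show "rational_set (multiples B) \<and> rational_set (free_numbers B)" by simp
qed

end
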